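(* Let $g^0,g^1,\dots,g^{T_\tau}:h\mathbb{Z}^3\to\mathbb{R}$ be the solution of the truncated explicit scheme (defined in the context), where $\tau=h^{2-\alpha}$, $h^{1-(\alpha+\beta)}\le \frac27$, $\alpha>0$, $\beta>\frac12$, $\alpha+\beta<1$. Then for all $1\le n\le T_\tau$, $$\|g^n\|_{\infty,h\mathbb{Z}^3}\le \|g^0\|_{\infty,h\mathbb{Z}^3}\le \|f^0\|_{L^\infty(\Omega)},$$ and for all $p\in[1,\infty)$, \begin{align*} \|g^n\|_{p,h\mathbb{Z}^3}^p&\le \|g^0\|_{p,h\mathbb{Z}^3}^p+\sum_{m=0}^{n-1}\sum_{x\in h\mathbb{Z}^3}(D\cdot\tilde u^m(x))\,|g^m(x)|^p h^3\tau\\ &=\|g^0\|_{p,\Omega_h}^p+\sum_{m=0}^{n-1}\sum_{x\in\Omega_h}(D\cdot\tilde u^m(x))\,|g^m(x)|^p h^3\tau\\ &\le \|f^0\|_{L^p(\Omega)}^p+\sum_{m=0}^{n-1}\sum_{x\in\Omega_h}(D\cdot\tilde u^m(x))\,|g^m(x)|^p h^3\tau . \end{align*} Furthermore, the comparison principle holds: if $\tilde g^n$ denotes the solution of the same scheme (same $\tilde u^n$, same $h,\tau$) with initial data $\tilde g^0:h\mathbb{Z}^3\to\mathbb{R}$ in place of $g^0$, and $g^0\le\tilde g^0$ on $h\mathbb{Z}^3$, then $g^n\le \tilde g^n$ on $h\mathbb{Z}^3$ for all $n=1,\dots,T_\tau$.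
   Context: Setting. $T>0$; $\Omega\subset\mathbb{R}^3$ is a bounded connected open set; $v\in L^2([0,T];H^1_0(\Omega)^3)\cap L^\infty([0,T];L^2(\Omega)^3)$ with $\nabla\cdot v=0$ and $\mathrm{supp}(v)\subset[0,T]\times\Omega$ (so $v$ vanishes for $x$ near $\partial\Omega$); $f^0\in L^\infty(\Omega)$ with $f^0\equiv0$ in a neighborhood of $\partial\Omega$. $\tilde v,\tilde f^0$ are the extensions of $v,f^0$ by $0$ to $x\in\mathbb{R}^3\setminus\Omega$. Grid. $h,\tau>0$ are the space and time mesh sizes, $t_n=n\tau$, and $T_\tau\in\mathbb{N}$ is such that $T\in[\tau T_\tau,\tau T_\tau+\tau)$. $h\mathbb{Z}^3=\{(hz_1,hz_2,hz_3): z_i\in\mathbb{Z}\}$; $e^1,e^2,e^3$ is the standard basis; $B=\{\pm e^1,\pm e^2,\pm e^3,0\}$; $C_h(x)=\prod_{i=1}^3[x_i-\frac h2,x_i+\frac h2)$; $\Omega_h=\{x\in\Omega\cap h\mathbb{Z}^3: C_{2h}(x)\subset\Omega\}$. The boundary of $A\subset h\mathbb{Z}^3$ is $\partial A=\{x\in A:\{x\pm he^i: i=1,2,3\}\not\subset A\}$. $D_j\phi(x)=\frac{\phi(x+he^j)-\phi(x-he^j)}{2h}$ and $D\cdot w=\sum_{j}D_jw_j$. For $A\subset h\mathbb{Z}^3$: $\|\phi\|_{p,A}=(\sum_{x\in A}|\phi(x)|^ph^3)^{1/p}$, $\|\phi\|_{\infty,A}=\max_{x\in A}|\phi(x)|$.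 Discrete data. $g^0(x)=\frac1{h^3}\int_{C_h(x)}\tilde f^0(y)\,dy$ for $x\in h\mathbb{Z}^3$; $u^n_i(x)=\frac{1}{\tau h^3}\int_{\tau n}^{\tau(n+1)}\int_{C_h(x)}\tilde v_i(s,y)\,dy\,ds$ for $x\in h\mathbb{Z}^3$, $0\le n\le T_\tau-1$. Standing assumption: $h$ is small enough that $g^0$ and all $u^n$ vanish near $\partial\Omega_h$ (in particular on $\partial\Omega_h$) and on $h\mathbb{Z}^3\setminus\Omega_h$. Truncation: $\tilde u^n_j(x)=u^n_j(x)$ if $|u^n_j(x)|\le h^{-\beta}$, and $\tilde u^n_j(x)=\mathrm{sign}(u^n_j(x))h^{-\beta}$ if $|u^n_j(x)|>h^{-\beta}$. Truncated explicit scheme. For $n=0,\dots,T_\tau-1$ and $x\in h\mathbb{Z}^3$, $$\Big(g^{n+1}(x)-\frac17\sum_{\omega\in B}g^n(x+h\omega)\Big)\frac1\tau+\sum_{j=1}^3\tilde u^n_j(x)D_jg^n(x)=0 .$$ *)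

theory Defs
  imports "HOL-Analysis.Analysis" "HOL-Probability.Essential_Supremum"
begin

section \<open>Function spaces\<close>

definition partial_deriv :: "3 \<Rightarrow> (real^3 \<Rightarrow> real) \<Rightarrow> real^3 \<Rightarrow> real" where
  "partial_deriv i \<phi> x = frechet_derivative \<phi> (at x) (axis i 1)"

text \<open>\<open>C\<^sup>\<infinity>\<close> on the whole space: all iterated partial derivatives exist and are (totally)
  differentiable, hence also continuous.\<close>

coinductive smooth :: "(real^3 \<Rightarrow> real) \<Rightarrow> bool" where
  "(\<forall>x. \<phi> differentiable at x) \<Longrightarrow> (\<forall>i. smooth (partial_deriv i \<phi>)) \<Longrightarrow> smooth \<phi>"

definition test_function :: "(real^3) set \<Rightarrow> (real^3 \<Rightarrow> real) \<Rightarrow> bool" where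
  "test_function \<Omega> \<phi> \<longleftrightarrow> smooth \<phi> \<and>
     compact (closure {x. \<phi> x \<noteq> 0}) \<and> closure {x. \<phi> x \<noteq> 0} \<subseteq> \<Omega>"

definition square_integrable :: "'a measure \<Rightarrow> ('a \<Rightarrow> 'b::euclidean_space) \<Rightarrow> bool" where
  "square_integrable M w \<longleftrightarrow> w \<in> borel_measurable M \<and> integrable M (\<lambda>x. (norm (w x))\<^sup>2)"

definition weak_gradient :: "(real^3) set \<Rightarrow> (real^3 \<Rightarrow> real) \<Rightarrow> (real^3 \<Rightarrow> real^3) \<Rightarrow> bool" where
  "weak_gradient \<Omega> w G \<longleftrightarrow> (\<forall>\<phi> i. test_function \<Omega> \<phi> \<longrightarrow>
     (LINT x|lebesgue_on \<Omega>. w x * partial_deriv i \<phi> x) = - (LINT x|lebesgue_on \<Omega>. G x $ i * \<phi> x))"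

text \<open>\<open>H1_0 \<Omega> w G\<close>: the function \<open>w\<close> lies in \<open>H\<^sup>1\<^sub>0(\<Omega>)\<close>, the closure of the test functions
  in \<open>H\<^sup>1(\<Omega>)\<close>, and \<open>G\<close> is (a representative of) its weak gradient.\<close>

definition H1_0 :: "(real^3) set \<Rightarrow> (real^3 \<Rightarrow> real) \<Rightarrow> (real^3 \<Rightarrow> real^3) \<Rightarrow> bool" where
  "H1_0 \<Omega> w G \<longleftrightarrow>
     square_integrable (lebesgue_on \<Omega>) w \<and> square_integrable (lebesgue_on \<Omega>) G \<and>
     weak_gradient \<Omega> w G \<and>
     (\<exists>\<phi> :: nat \<Rightarrow> real^3 \<Rightarrow> real. (\<forall>k. test_function \<Omega> (\<phi> k)) \<and>
        (\<lambda>k. \<integral>\<^sup>+ x. ennreal ((\<phi> k x - w x)\<^sup>2 + (\<Sum>i\<in>UNIV. (partial_deriv i (\<phi> k) x - G x $ i)\<^sup>2))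
               \<partial>lebesgue_on \<Omega>) \<longlonglongrightarrow> 0)"

text \<open>\<open>L\<^sup>2([0,T]; H\<^sup>1\<^sub>0(\<Omega>)\<^sup>3)\<close> in terms of representatives that are jointly measurable in
  \<open>(t,x)\<close>: as \<open>H\<^sup>1\<^sub>0(\<Omega>)\<close> is separable, every Bochner measurable map has such a
  representative, with a jointly measurable gradient. Row \<open>i\<close> of \<open>G t x\<close> is the gradient
  of the \<open>i\<close>-th component of \<open>v t\<close> at \<open>x\<close>.\<close>

definition L2_H1_0 :: "real \<Rightarrow> (real^3) set \<Rightarrow> (real \<Rightarrow> real^3 \<Rightarrow> real^3) \<Rightarrow> bool" where
  "L2_H1_0 T \<Omega> v \<longleftrightarrow> (\<exists>G :: real \<Rightarrow> real^3 \<Rightarrow> real^3^3.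
     square_integrable (lebesgue_on ({0..T} \<times> \<Omega>)) (\<lambda>(t, x). v t x) \<and>
     square_integrable (lebesgue_on ({0..T} \<times> \<Omega>)) (\<lambda>(t, x). G t x) \<and>
     (AE t in lebesgue_on {0..T}. \<forall>i. H1_0 \<Omega> (\<lambda>x. v t x $ i) (\<lambda>x. G t x $ i)))"

definition Linf_L2 :: "real \<Rightarrow> (real^3) set \<Rightarrow> (real \<Rightarrow> real^3 \<Rightarrow> real^3) \<Rightarrow> bool" where
  "Linf_L2 T \<Omega> v \<longleftrightarrow>
     (\<lambda>(t, x). v t x) \<in> borel_measurable (lebesgue_on ({0..T} \<times> \<Omega>)) \<and>
     (\<exists>C :: real. AE t in lebesgue_on {0..T}.
        v t \<in> borel_measurable (lebesgue_on \<Omega>) \<and>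
        (\<integral>\<^sup>+ x. ennreal ((norm (v t x))\<^sup>2) \<partial>lebesgue_on \<Omega>) \<le> ennreal C)"

definition divergence_free :: "real \<Rightarrow> (real^3) set \<Rightarrow> (real \<Rightarrow> real^3 \<Rightarrow> real^3) \<Rightarrow> bool" where
  "divergence_free T \<Omega> v \<longleftrightarrow> (AE t in lebesgue_on {0..T}. \<forall>\<phi>. test_function \<Omega> \<phi> \<longrightarrow>
     (LINT x|lebesgue_on \<Omega>. (\<Sum>i\<in>UNIV. v t x $ i * partial_deriv i \<phi> x)) = 0)"

text \<open>The support of a class of functions modulo null sets.\<close>

definition ess_support :: "('a::euclidean_space \<Rightarrow> 'b::zero) \<Rightarrow> 'a set" where
  "ess_support f = {z. \<forall>U. open U \<and> z \<in> U \<longrightarrow> \<not> (AE y in lebesgue. y \<in> U \<longrightarrow> f y = 0)}"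

definition Linf :: "(real^3) set \<Rightarrow> (real^3 \<Rightarrow> real) \<Rightarrow> bool" where
  "Linf \<Omega> f \<longleftrightarrow> f \<in> borel_measurable (lebesgue_on \<Omega>) \<and>
     esssup (lebesgue_on \<Omega>) (\<lambda>x. ennreal \<bar>f x\<bar>) < top"

definition Linf_norm :: "(real^3) set \<Rightarrow> (real^3 \<Rightarrow> real) \<Rightarrow> ennreal" where
  "Linf_norm \<Omega> f = esssup (lebesgue_on \<Omega>) (\<lambda>x. ennreal \<bar>f x\<bar>)"

definition Lp_norm :: "real \<Rightarrow> (real^3) set \<Rightarrow> (real^3 \<Rightarrow> real) \<Rightarrow> real" where
  "Lp_norm p \<Omega> f = (LINT x|lebesgue_on \<Omega>. \<bar>f x\<bar> powr p) powr (1 / p)"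

definition zero_ext :: "'a set \<Rightarrow> ('a \<Rightarrow> 'b::zero) \<Rightarrow> 'a \<Rightarrow> 'b" where
  "zero_ext A f x = (if x \<in> A then f x else 0)"

section \<open>The grid\<close>

text \<open>Grid functions are functions on \<open>real^3\<close> of which only the values on \<open>grid h\<close> matter.\<close>

definition grid :: "real \<Rightarrow> (real^3) set" where
  "grid h = {x. \<exists>z :: 3 \<Rightarrow> int. \<forall>i. x $ i = h * of_int (z i)}"

definition stencil :: "(real^3) set" where
  "stencil = {0} \<union> (range (\<lambda>i. axis i 1) \<union> range (\<lambda>i. - axis i 1))"

definition cell :: "real \<Rightarrow> real^3 \<Rightarrow> (real^3) set" where
  "cell h x = {y. \<forall>i. x $ i - h / 2 \<le> y $ i \<and> y $ i < x $ i + h / 2}"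

definition grid_interior :: "real \<Rightarrow> (real^3) set \<Rightarrow> (real^3) set" where
  "grid_interior h \<Omega> = {x \<in> \<Omega> \<inter> grid h. cell (2 * h) x \<subseteq> \<Omega>}"

definition grid_boundary :: "real \<Rightarrow> (real^3) set \<Rightarrow> (real^3) set" where
  "grid_boundary h A =
     {x \<in> A. \<not> (\<Union>i. {x + h *\<^sub>R axis i 1, x - h *\<^sub>R axis i 1}) \<subseteq> A}"

definition central_diff :: "real \<Rightarrow> 3 \<Rightarrow> (real^3 \<Rightarrow> real) \<Rightarrow> real^3 \<Rightarrow> real" where
  "central_diff h j \<phi> x = (\<phi> (x + h *\<^sub>R axis j 1) - \<phi> (x - h *\<^sub>R axis j 1)) / (2 * h)"

definition discrete_div :: "real \<Rightarrow> (real^3 \<Rightarrow> real^3) \<Rightarrow> real^3 \<Rightarrow> real" where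
  "discrete_div h w x = (\<Sum>j\<in>UNIV. central_diff h j (\<lambda>y. w y $ j) x)"

text \<open>On an infinite set of grid points the sum is meaningful only for summable terms.\<close>

definition lp_norm :: "real \<Rightarrow> real \<Rightarrow> (real^3) set \<Rightarrow> (real^3 \<Rightarrow> real) \<Rightarrow> real" where
  "lp_norm h p A \<phi> = (\<Sum>\<^sub>\<infinity>x\<in>A. \<bar>\<phi> x\<bar> powr p * h ^ 3) powr (1 / p)"

text \<open>Supremum in \<^typ>\<open>ennreal\<close>, so that unbounded grid functions get the norm \<open>top\<close>; it is a
  maximum for finitely supported grid functions.\<close>

definition linf_norm :: "(real^3) set \<Rightarrow> (real^3 \<Rightarrow> real) \<Rightarrow> ennreal" where
  "linf_norm A \<phi> = (SUP x\<in>A. ennreal \<bar>\<phi> x\<bar>)"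

section \<open>Discrete data and the scheme\<close>

definition initial_avg :: "real \<Rightarrow> (real^3) set \<Rightarrow> (real^3 \<Rightarrow> real) \<Rightarrow> real^3 \<Rightarrow> real" where
  "initial_avg h \<Omega> f x = 1 / h ^ 3 * (LINT y:cell h x|lebesgue. zero_ext \<Omega> f y)"

definition velocity_avg ::
  "real \<Rightarrow> real \<Rightarrow> (real^3) set \<Rightarrow> (real \<Rightarrow> real^3 \<Rightarrow> real^3) \<Rightarrow> nat \<Rightarrow> real^3 \<Rightarrow> real^3" where
  "velocity_avg h \<tau> \<Omega> v n x = (\<chi> i. 1 / (\<tau> * h ^ 3) *
     (LINT s:{\<tau> * real n..\<tau> * (real n + 1)}|lebesgue.
       (LINT y:cell h x|lebesgue. zero_ext \<Omega> (v s) y $ i)))"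

definition truncate_vec :: "real \<Rightarrow> real^3 \<Rightarrow> real^3" where
  "truncate_vec M w = (\<chi> j. if \<bar>w $ j\<bar> \<le> M then w $ j else sgn (w $ j) * M)"

definition solves_scheme ::
  "real \<Rightarrow> real \<Rightarrow> nat \<Rightarrow> (nat \<Rightarrow> real^3 \<Rightarrow> real^3) \<Rightarrow> (nat \<Rightarrow> real^3 \<Rightarrow> real) \<Rightarrow> bool" where
  "solves_scheme h \<tau> N u g \<longleftrightarrow> (\<forall>n<N. \<forall>x\<in>grid h.
     (g (Suc n) x - 1 / 7 * (\<Sum>\<omega>\<in>stencil. g n (x + h *\<^sub>R \<omega>))) * (1 / \<tau>)
       + (\<Sum>j\<in>UNIV. u n x $ j * central_diff h j (g n) x) = 0)"

end

theory Submission
  imports Defs "HOL-Probability.Probability_Measure"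
begin

text \<open>One step of the scheme replaces the value at a grid point \<open>x\<close> by the combination of the
  values at \<open>x + h\<omega>\<close>, \<open>\<omega>\<close> in the seven-point stencil, with the weights
  \<open>1/7 - \<tau>/(2h) (w(x) \<bullet> \<omega>)\<close>. These add up to \<open>1\<close>, and the truncation \<open>|w| \<le> h\<^sup>-\<^sup>\<beta>\<close> together with
  \<open>\<tau> = h\<^sup>2\<^sup>-\<^sup>\<alpha>\<close> makes them nonnegative. So a step is monotone and does not increase the maximum norm,
  and by Jensen's inequality the step of \<open>|g|\<^sup>p\<close> dominates the \<open>p\<close>-th power of the step of \<open>g\<close>;
  summation by parts then yields the divergence term. The bounds on \<open>g\<^sup>0\<close> are Jensen's inequality on
  each cell. No divergence term arises outside \<open>\<Omega>\<^sub>h\<close>, because a point of \<open>\<Omega>\<^sub>h\<close> with a neighbour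
  outside belongs to the boundary, where the velocity vanishes.\<close>

section \<open>Convexity of the \<open>p\<close>-th power of the modulus\<close>

text \<open>Positive arguments are covered by \<open>powr_convex\<close>. If one argument is
  \<open>0\<close>, the claim reduces to \<open>s powr p \<le> s\<close> for
  \<open>0 < s < 1\<close>, which is the content of \<open>scaled\<close>. The triangle inequality
  and monotonicity of the power pass to arbitrary signs.\<close>

lemma convex_abs_powr:
  fixes p :: real
  assumes "1 \<le> p"
  shows "convex_on UNIV (\<lambda>x::real. \<bar>x\<bar> powr p)"
proof (rule convex_onI)
  fix t x y :: real
  assume t: "0 < t" "t < 1"
  have scaled: "(s * a) powr p \<le> s * a powr p" if "0 < s" "s < 1" "0 \<le> a" for s a
  proof -
    have "s powr p \<le> s powr 1"
      using that assms by (intro powr_mono') auto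
    then show ?thesis
      using that by (simp add: powr_mult mult_right_mono)
  qed
  have nonneg: "((1 - t) * a + t * b) powr p \<le> (1 - t) * a powr p + t * b powr p"
    if ab: "0 \<le> a" "0 \<le> b" for a b
  proof (cases "a = 0 \<or> b = 0")
    case True
    then show ?thesis
      using scaled[of t b] scaled[of "1 - t" a] t ab assms by auto
  next
    case False
    then show ?thesis
      using convex_onD[OF powr_convex[OF assms], of t a b] t ab by simp
  qed
  have "\<bar>(1 - t) *\<^sub>R x + t *\<^sub>R y\<bar> \<le> (1 - t) * \<bar>x\<bar> + t * \<bar>y\<bar>"
    using t abs_triangle_ineq[of "(1 - t) * x" "t * y"] by (simp add: abs_mult)
  then have "\<bar>(1 - t) *\<^sub>R x + t *\<^sub>R y\<bar> powr p \<le> ((1 - t) * \<bar>x\<bar> + t * \<bar>y\<bar>) powr p"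
    using assms by (intro powr_mono2) auto
  also have "\<dots> \<le> (1 - t) * \<bar>x\<bar> powr p + t * \<bar>y\<bar> powr p"
    by (rule nonneg) auto
  finally show "\<bar>(1 - t) *\<^sub>R x + t *\<^sub>R y\<bar> powr p \<le> (1 - t) * \<bar>x\<bar> powr p + t * \<bar>y\<bar> powr p" .
qed simp

section \<open>The grid and the seven-point stencil\<close>

text \<open>In units of \<open>h\<close>, a grid point has integer coordinates; boundedness of
  \<open>S\<close> confines them to \<open>{-K..K}\<close>, and there are three of them.\<close>

lemma finite_grid_bounded:
  assumes "h > 0" "bounded S"
  shows "finite (grid h \<inter> S)"
proof -
  obtain B where B: "\<And>x. x \<in> S \<Longrightarrow> norm x \<le> B"
    using assms(2) by (auto simp: bounded_iff)
  define K where "K = \<lceil>B / h\<rceil>"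
  let ?Z = "{z :: 3 \<Rightarrow> int. \<forall>i. z i \<in> {-K..K}}"
  have "grid h \<inter> S \<subseteq> (\<lambda>z. \<chi> i. h * of_int (z i)) ` ?Z"
  proof
    fix x assume x: "x \<in> grid h \<inter> S"
    then obtain z :: "3 \<Rightarrow> int" where z: "\<And>i. x $ i = h * of_int (z i)"
      by (auto simp: grid_def)
    have "z i \<in> {-K..K}" for i
    proof -
      have "\<bar>h * of_int (z i)\<bar> \<le> B"
        using B[of x] x component_le_norm_cart[of x i] by (simp add: z)
      then have "\<bar>of_int (z i)\<bar> \<le> B / h"
        using assms(1) by (simp add: abs_mult field_simps)
      then have "\<bar>of_int (z i) :: real\<bar> \<le> of_int K"
        unfolding K_def by linarith
      then show ?thesis by (auto simp: abs_le_iff)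
    qed
    then show "x \<in> (\<lambda>z. \<chi> i. h * of_int (z i)) ` ?Z"
      by (intro image_eqI[of _ _ z]) (auto simp: vec_eq_iff z)
  qed
  \<comment> \<open>\<open>undefined\<close> is the default value off the index set; that set is all
    of \<open>3\<close>, so the functions counted are exactly those in \<open>?Z\<close>.\<close>
  moreover have "finite ?Z"
    using finite_set_of_finite_funs[of "UNIV :: 3 set" "{-K..K}" undefined] by simp
  ultimately show ?thesis
    using finite_subset by blast
qed

lemma grid_add: "x \<in> grid h \<Longrightarrow> y \<in> grid h \<Longrightarrow> x + y \<in> grid h"
  unfolding grid_def
proof clarsimp
  fix z w :: "3 \<Rightarrow> int"
  show "\<exists>k :: 3 \<Rightarrow> int. \<forall>i. h * of_int (z i) + h * of_int (w i) = h * of_int (k i)"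
    by (rule exI[of _ "\<lambda>i. z i + w i"]) (simp add: distrib_left)
qed

lemma grid_uminus: "x \<in> grid h \<Longrightarrow> - x \<in> grid h"
  unfolding grid_def
proof clarsimp
  fix z :: "3 \<Rightarrow> int"
  show "\<exists>k :: 3 \<Rightarrow> int. \<forall>i. - (h * of_int (z i)) = h * of_int (k i)"
    by (rule exI[of _ "\<lambda>i. - z i"]) simp
qed

lemma grid_stencil: "\<omega> \<in> stencil \<Longrightarrow> h *\<^sub>R \<omega> \<in> grid h"
proof -
  have "h *\<^sub>R axis j 1 \<in> grid h" for j
    unfolding grid_def by (auto simp: axis_def intro!: exI[of _ "\<lambda>i. if i = j then 1 else 0"])
  moreover have "(0 :: real^3) \<in> grid h"
    unfolding grid_def by (auto intro!: exI[of _ "\<lambda>_. 0"])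
  moreover assume "\<omega> \<in> stencil"
  ultimately show ?thesis
    using grid_uminus[of "h *\<^sub>R axis _ 1" h] by (auto simp: stencil_def)
qed

text \<open>The seven points are distinct, so the sum splits into the centre and three opposite
  pairs, the shape in which central differences appear.\<close>

lemma sum_stencil:
  fixes F :: "real^3 \<Rightarrow> real"
  shows "(\<Sum>\<omega>\<in>stencil. F \<omega>) = F 0 + (\<Sum>j\<in>UNIV. F (axis j 1) + F (- axis j 1))"
proof -
  have inj: "inj (\<lambda>i::3. axis i (1::real))" "inj (\<lambda>i::3. - axis i (1::real))"
    by (auto simp: inj_on_def axis_eq_axis)
  have "axis i (1::real) \<noteq> - axis j 1" for i j :: 3
  proof
    assume "axis i (1::real) = - axis j 1"
    then have "axis i (1::real) $ i = (- axis j 1) $ i" by simp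
    then show False by (simp add: axis_def split: if_splits)
  qed
  then have disj: "range (\<lambda>i::3. axis i (1::real)) \<inter> range (\<lambda>i. - axis i 1) = {}"
    by auto
  have "0 \<notin> range (\<lambda>i::3. axis i (1::real)) \<union> range (\<lambda>i. - axis i 1)"
    by (auto simp: axis_eq_0_iff)
  then show ?thesis
    unfolding stencil_def
    by (simp add: sum.union_disjoint disj sum.reindex inj sum.distrib)
qed

lemma finite_stencil: "finite stencil"
  by (simp add: stencil_def)

lemma stencil_nonempty: "stencil \<noteq> {}"
  by (simp add: stencil_def)

lemma card_stencil: "card stencil = 7"
  using sum_stencil[of "\<lambda>_. 1"] by simp

text \<open>For \<open>\<omega>\<close> equal to plus or minus \<open>axis j 1\<close>, the product
  \<open>w \<bullet> \<omega>\<close> is plus or minus \<open>w $ j\<close>, the signed coefficient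
  in the difference quotient; the centre contributes nothing because
  \<open>w \<bullet> 0 = 0\<close>. The divergence below is rewritten in the same way.\<close>

lemma central_diff_stencil:
  "(\<Sum>j\<in>UNIV. w $ j * central_diff h j \<phi> x) = (\<Sum>\<omega>\<in>stencil. (w \<bullet> \<omega>) * \<phi> (x + h *\<^sub>R \<omega>)) / (2 * h)"
  by (simp add: sum_stencil central_diff_def inner_axis sum_divide_distrib right_diff_distrib)

lemma discrete_div_stencil:
  "discrete_div h w x = (\<Sum>\<omega>\<in>stencil. w (x + h *\<^sub>R \<omega>) \<bullet> \<omega>) / (2 * h)"
  by (simp add: sum_stencil discrete_div_def central_diff_def inner_axis sum_divide_distrib)

lemma sum_stencil_uminus:
  fixes F :: "real^3 \<Rightarrow> real"
  shows "(\<Sum>\<omega>\<in>stencil. F (- \<omega>)) = (\<Sum>\<omega>\<in>stencil. F \<omega>)"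
  by (simp add: sum_stencil add.commute)

section \<open>One time step as a weighted average\<close>

text \<open>The velocity enters as a vector and not as a field, so that summation by parts can
  sample it at a shifted point.\<close>

definition stencil_weight :: "real \<Rightarrow> real \<Rightarrow> real^3 \<Rightarrow> real^3 \<Rightarrow> real" where
  "stencil_weight h \<tau> w \<omega> = 1 / 7 - \<tau> / (2 * h) * (w \<bullet> \<omega>)"

text \<open>Opposite directions cancel in the velocity part, leaving seven times
  \<open>1 / 7\<close>.\<close>

lemma sum_stencil_weight: "(\<Sum>\<omega>\<in>stencil. stencil_weight h \<tau> w \<omega>) = 1"
  by (simp add: stencil_weight_def sum_stencil)

text \<open>Up to sign, \<open>w \<bullet> \<omega>\<close> is a component of \<open>w\<close> or
  \<open>0\<close>. The threshold \<open>2 / 7 * h\<close> is \<open>1 / 7\<close> multiplied by the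
  denominator \<open>2 * h\<close>.\<close>

lemma stencil_weight_nonneg:
  assumes "h > 0" "\<tau> > 0" "\<And>j. \<tau> * \<bar>w $ j\<bar> \<le> 2 / 7 * h" "\<omega> \<in> stencil"
  shows "0 \<le> stencil_weight h \<tau> w \<omega>"
proof -
  have "\<bar>w \<bullet> \<omega>\<bar> * \<tau> \<le> 2 / 7 * h"
    using assms by (auto simp: stencil_def inner_axis mult.commute)
  then have "\<tau> * (w \<bullet> \<omega>) \<le> 2 / 7 * h"
    using assms(2) abs_le_D1[of "\<tau> * (w \<bullet> \<omega>)" "2 / 7 * h"]
    by (simp add: abs_mult mult.commute)
  then show ?thesis
    using assms(1) by (simp add: stencil_weight_def field_simps)
qed

definition scheme_update :: "real \<Rightarrow> real \<Rightarrow> (real^3 \<Rightarrow> real^3) \<Rightarrow> (real^3 \<Rightarrow> real) \<Rightarrow> real^3 \<Rightarrow> real" where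
  "scheme_update h \<tau> w \<phi> x = (\<Sum>\<omega>\<in>stencil. stencil_weight h \<tau> (w x) \<omega> * \<phi> (x + h *\<^sub>R \<omega>))"

lemma solves_scheme_iff_update:
  assumes "\<tau> > 0"
  shows "solves_scheme h \<tau> N w g \<longleftrightarrow>
    (\<forall>n<N. \<forall>x\<in>grid h. g (Suc n) x = scheme_update h \<tau> (w n) (g n) x)"
proof -
  have "((a - S) * (1 / \<tau>) + C = 0) \<longleftrightarrow> a = S - \<tau> * C" for a S C :: real
    using assms by (auto simp: field_simps)
  moreover have "scheme_update h \<tau> (w n) (g n) x =
      1 / 7 * (\<Sum>\<omega>\<in>stencil. g n (x + h *\<^sub>R \<omega>))
        - \<tau> * (\<Sum>j\<in>UNIV. w n x $ j * central_diff h j (g n) x)" for n x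
    unfolding central_diff_stencil scheme_update_def stencil_weight_def
    by (simp add: left_diff_distrib sum_subtractf sum_distrib_left sum_divide_distrib mult.assoc)
  ultimately show ?thesis
    unfolding solves_scheme_def by simp
qed

lemma scheme_update_mono:
  assumes "h > 0" "\<tau> > 0" "\<And>j. \<tau> * \<bar>w x $ j\<bar> \<le> 2 / 7 * h" "x \<in> grid h"
    and "\<And>y. y \<in> grid h \<Longrightarrow> \<phi> y \<le> \<psi> y"
  shows "scheme_update h \<tau> w \<phi> x \<le> scheme_update h \<tau> w \<psi> x"
  unfolding scheme_update_def
  by (intro sum_mono mult_left_mono assms(5) grid_add[OF assms(4)] grid_stencil
      stencil_weight_nonneg[OF assms(1-3)])

text \<open>The weights at \<open>x\<close> form a probability vector on the stencil, so this is the
  finite Jensen inequality.\<close>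

lemma scheme_update_jensen:
  assumes "h > 0" "\<tau> > 0" "\<And>j. \<tau> * \<bar>w x $ j\<bar> \<le> 2 / 7 * h"
    and "convex_on UNIV q"
  shows "q (scheme_update h \<tau> w \<phi> x) \<le> scheme_update h \<tau> w (\<lambda>y. q (\<phi> y)) x"
  using convex_on_sum[OF finite_stencil stencil_nonempty assms(4),
      of "stencil_weight h \<tau> (w x)" "\<lambda>\<omega>. \<phi> (x + h *\<^sub>R \<omega>)"]
    stencil_weight_nonneg[OF assms(1-3)]
  by (simp add: scheme_update_def sum_stencil_weight)

lemma scheme_update_bound:
  assumes "h > 0" "\<tau> > 0" "\<And>j. \<tau> * \<bar>w x $ j\<bar> \<le> 2 / 7 * h" "x \<in> grid h"
    and "\<And>y. y \<in> grid h \<Longrightarrow> \<bar>\<phi> y\<bar> \<le> M"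
  shows "\<bar>scheme_update h \<tau> w \<phi> x\<bar> \<le> M"
proof -
  have "\<bar>scheme_update h \<tau> w \<phi> x\<bar> \<le> (\<Sum>\<omega>\<in>stencil. \<bar>stencil_weight h \<tau> (w x) \<omega> * \<phi> (x + h *\<^sub>R \<omega>)\<bar>)"
    unfolding scheme_update_def by (rule sum_abs)
  also have "\<dots> \<le> (\<Sum>\<omega>\<in>stencil. stencil_weight h \<tau> (w x) \<omega> * M)"
    using assms stencil_weight_nonneg[OF assms(1-3)]
    by (intro sum_mono) (auto simp: abs_mult intro!: mult_left_mono grid_add grid_stencil)
  also have "\<dots> = M"
    by (simp add: sum_distrib_right[symmetric] sum_stencil_weight)
  finally show ?thesis .
qed

text \<open>A nonzero new value requires a nonzero old value at some stencil neighbour, so the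
  support grows by at most one stencil per step. Sums over the infinite grid thereby stay
  summable.\<close>

lemma scheme_update_finite_support:
  assumes "finite {x \<in> grid h. \<phi> x \<noteq> 0}"
  shows "finite {x \<in> grid h. scheme_update h \<tau> w \<phi> x \<noteq> 0}"
proof (rule finite_subset)
  show "{x \<in> grid h. scheme_update h \<tau> w \<phi> x \<noteq> 0} \<subseteq>
      (\<Union>\<omega>\<in>stencil. (\<lambda>y. y - h *\<^sub>R \<omega>) ` {x \<in> grid h. \<phi> x \<noteq> 0})"
  proof clarify
    fix x assume x: "x \<in> grid h" "scheme_update h \<tau> w \<phi> x \<noteq> 0"
    then obtain \<omega> where \<omega>: "\<omega> \<in> stencil" "\<phi> (x + h *\<^sub>R \<omega>) \<noteq> 0"
      unfolding scheme_update_def by (metis (no_types, lifting) mult_zero_right sum.neutral)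
    then have "x + h *\<^sub>R \<omega> \<in> {x \<in> grid h. \<phi> x \<noteq> 0}"
      using x grid_add grid_stencil by auto
    then show "x \<in> (\<Union>\<omega>\<in>stencil. (\<lambda>y. y - h *\<^sub>R \<omega>) ` {x \<in> grid h. \<phi> x \<noteq> 0})"
      using \<omega> by (intro UN_I[of \<omega>] image_eqI[of _ _ "x + h *\<^sub>R \<omega>"]) auto
  qed
  show "finite (\<Union>\<omega>\<in>stencil. (\<lambda>y. y - h *\<^sub>R \<omega>) ` {x \<in> grid h. \<phi> x \<noteq> 0})"
    using assms finite_stencil by auto
qed

section \<open>Summation by parts on the grid\<close>

lemma summable_on_finite_support:
  fixes f :: "'a \<Rightarrow> real"
  assumes "finite {x \<in> A. f x \<noteq> 0}"
  shows "f summable_on A"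
  unfolding summable_on_def
  by (rule exI, rule has_sum_finite_neutralI[OF assms _ _ refl]) auto

lemma has_sum_sum:
  fixes f :: "'i \<Rightarrow> 'a \<Rightarrow> real"
  assumes "finite I" "\<And>i. i \<in> I \<Longrightarrow> (f i has_sum s i) A"
  shows "((\<lambda>x. \<Sum>i\<in>I. f i x) has_sum (\<Sum>i\<in>I. s i)) A"
  using assms by (induction I rule: finite_induct) (auto intro: has_sum_add)

text \<open>Shifting the summation variable moves the weights from the stencil onto \<open>\<psi>\<close>: seen from
  the point \<open>y\<close>, they add up to \<open>1\<close> plus \<open>\<tau>\<close> times the discrete divergence of \<open>w\<close>.\<close>

lemma infsum_scheme_update:
  assumes fin: "finite {x \<in> grid h. \<psi> x \<noteq> 0}"
  shows "(\<Sum>\<^sub>\<infinity>x\<in>grid h. scheme_update h \<tau> w \<psi> x) =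
    (\<Sum>\<^sub>\<infinity>x\<in>grid h. (1 + \<tau> * discrete_div h w x) * \<psi> x)"
proof -
  \<comment> \<open>Chosen such that \<open>c \<omega> (x + h *\<^sub>R \<omega>)\<close> is the
    \<open>\<omega>\<close>-term of the update at \<open>x\<close>. Translation by
    \<open>h *\<^sub>R \<omega>\<close> permutes the grid, so \<open>c \<omega>\<close> and its
    translate have the same sum.\<close>
  define c where "c \<omega> x = stencil_weight h \<tau> (w (x - h *\<^sub>R \<omega>)) \<omega> * \<psi> x" for \<omega> x
  have bij: "bij_betw (\<lambda>x. x + h *\<^sub>R \<omega>) (grid h) (grid h)" if "\<omega> \<in> stencil" for \<omega>
    using grid_stencil[OF that, of h] grid_add[of _ h "h *\<^sub>R \<omega>"]
      grid_add[of _ h "- (h *\<^sub>R \<omega>)"] grid_uminus[of "h *\<^sub>R \<omega>" h]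
    by (intro bij_betw_byWitness[where f' = "\<lambda>x. x - h *\<^sub>R \<omega>"]) auto
  have "finite {x \<in> grid h. c \<omega> x \<noteq> 0}" for \<omega>
    by (rule finite_subset[OF _ fin]) (auto simp: c_def)
  then have "(c \<omega> has_sum (\<Sum>\<^sub>\<infinity>x\<in>grid h. c \<omega> x)) (grid h)" for \<omega>
    by (intro has_sum_infsum summable_on_finite_support)
  then have sum_c: "((\<lambda>x. c \<omega> (x + h *\<^sub>R \<omega>)) has_sum (\<Sum>\<^sub>\<infinity>x\<in>grid h. c \<omega> x)) (grid h)"
    "(c \<omega> has_sum (\<Sum>\<^sub>\<infinity>x\<in>grid h. c \<omega> x)) (grid h)" if "\<omega> \<in> stencil" for \<omega>
    using has_sum_reindex_bij_betw[OF bij[OF that]] by blast+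
  have "(\<Sum>\<omega>\<in>stencil. c \<omega> x) = (1 + \<tau> * discrete_div h w x) * \<psi> x" for x
  proof -
    \<comment> \<open>Replacing \<open>\<omega>\<close> by \<open>- \<omega>\<close> reverses the
      sign; with the minus sign in \<open>stencil_weight\<close> the divergence enters
      positively.\<close>
    have "(\<Sum>\<omega>\<in>stencil. w (x - h *\<^sub>R \<omega>) \<bullet> \<omega>) = - (\<Sum>\<omega>\<in>stencil. w (x + h *\<^sub>R \<omega>) \<bullet> \<omega>)"
      using sum_stencil_uminus[of "\<lambda>\<omega>. w (x - h *\<^sub>R \<omega>) \<bullet> \<omega>"] by (simp add: sum_negf)
    then have "(\<Sum>\<omega>\<in>stencil. stencil_weight h \<tau> (w (x - h *\<^sub>R \<omega>)) \<omega>)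
        = 1 + \<tau> * discrete_div h w x"
      by (simp add: stencil_weight_def sum_subtractf card_stencil discrete_div_stencil
          flip: sum_distrib_left sum_divide_distrib)
    then show ?thesis
      by (simp add: c_def flip: sum_distrib_right)
  qed
  then have "((\<lambda>x. (1 + \<tau> * discrete_div h w x) * \<psi> x) has_sum
      (\<Sum>\<omega>\<in>stencil. \<Sum>\<^sub>\<infinity>x\<in>grid h. c \<omega> x)) (grid h)"
    using has_sum_sum[OF finite_stencil, of c, OF sum_c(2)] by simp
  moreover have "((\<lambda>x. scheme_update h \<tau> w \<psi> x) has_sum
      (\<Sum>\<omega>\<in>stencil. \<Sum>\<^sub>\<infinity>x\<in>grid h. c \<omega> x)) (grid h)"
    using has_sum_sum[OF finite_stencil, of "\<lambda>\<omega> x. c \<omega> (x + h *\<^sub>R \<omega>)", OF sum_c(1)]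
    by (simp add: c_def scheme_update_def)
  ultimately show ?thesis
    by (simp add: infsumI)
qed

text \<open>Pointwise Jensen followed by \<open>infsum_scheme_update\<close> applied to
  \<open>q\<close> composed with \<open>\<phi>\<close>. The condition \<open>q 0 = 0\<close> keeps
  the supports finite, so that the sums can be compared and split.\<close>

lemma infsum_scheme_update_jensen:
  assumes "h > 0" "\<tau> > 0" "\<And>x j. \<tau> * \<bar>w x $ j\<bar> \<le> 2 / 7 * h"
    and q: "convex_on UNIV q" "q 0 = 0"
    and fin: "finite {x \<in> grid h. \<phi> x \<noteq> 0}"
  shows "(\<Sum>\<^sub>\<infinity>x\<in>grid h. q (scheme_update h \<tau> w \<phi> x)) \<le>
    (\<Sum>\<^sub>\<infinity>x\<in>grid h. q (\<phi> x)) + (\<Sum>\<^sub>\<infinity>x\<in>grid h. discrete_div h w x * q (\<phi> x) * \<tau>)"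
proof -
  have fin_q: "finite {x \<in> grid h. q (\<phi> x) \<noteq> 0}"
    by (rule finite_subset[OF _ fin]) (auto simp: q)
  have fin_div: "finite {x \<in> grid h. discrete_div h w x * q (\<phi> x) * \<tau> \<noteq> 0}"
    by (rule finite_subset[OF _ fin]) (auto simp: q)
  have fin_update: "finite {x \<in> grid h. q (scheme_update h \<tau> w \<phi> x) \<noteq> 0}"
    by (rule finite_subset[OF _ scheme_update_finite_support[OF fin, of \<tau> w]]) (auto simp: q)
  have "(\<Sum>\<^sub>\<infinity>x\<in>grid h. q (scheme_update h \<tau> w \<phi> x))
      \<le> (\<Sum>\<^sub>\<infinity>x\<in>grid h. scheme_update h \<tau> w (\<lambda>y. q (\<phi> y)) x)"
    by (intro infsum_mono summable_on_finite_support fin_update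
        scheme_update_finite_support[OF fin_q] scheme_update_jensen assms)
  also have "\<dots> = (\<Sum>\<^sub>\<infinity>x\<in>grid h. (1 + \<tau> * discrete_div h w x) * q (\<phi> x))"
    by (rule infsum_scheme_update[OF fin_q])
  also have "\<dots> = (\<Sum>\<^sub>\<infinity>x\<in>grid h. q (\<phi> x) + discrete_div h w x * q (\<phi> x) * \<tau>)"
    by (intro infsum_cong) (simp add: algebra_simps)
  also have "\<dots> = (\<Sum>\<^sub>\<infinity>x\<in>grid h. q (\<phi> x)) + (\<Sum>\<^sub>\<infinity>x\<in>grid h. discrete_div h w x * q (\<phi> x) * \<tau>)"
    by (intro infsum_add summable_on_finite_support fin_q fin_div)
  finally show ?thesis .
qed

lemma discrete_div_eq_0_outside:
  assumes "\<And>y. y \<in> grid_boundary h A \<union> (grid h - A) \<Longrightarrow> w y = 0" and "x \<in> grid h - A"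
  shows "discrete_div h w x = 0"
proof -
  have "w (x + h *\<^sub>R \<omega>) = 0" if \<omega>: "\<omega> \<in> stencil" for \<omega>
  proof (cases "x + h *\<^sub>R \<omega> \<in> A")
    case False
    then show ?thesis
      using assms grid_stencil[OF \<omega>, of h] grid_add[of x h "h *\<^sub>R \<omega>"] by auto
  next
    case True
    \<comment> \<open>The direction \<open>\<omega> = 0\<close> is excluded, since \<open>x\<close>
      lies outside \<open>A\<close> while its neighbour lies inside. Stepping back along the same
      axis leads from the neighbour to \<open>x\<close>, which puts the neighbour on the boundary of
      \<open>A\<close>.\<close>
    then obtain j where "\<omega> = axis j 1 \<or> \<omega> = - axis j 1"
      using \<omega> assms(2) by (auto simp: stencil_def)
    then have "x = (x + h *\<^sub>R \<omega>) + h *\<^sub>R axis j 1 \<or> x = (x + h *\<^sub>R \<omega>) - h *\<^sub>R axis j 1"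
      by auto
    then have "x \<in> (\<Union>i. {(x + h *\<^sub>R \<omega>) + h *\<^sub>R axis i 1, (x + h *\<^sub>R \<omega>) - h *\<^sub>R axis i 1})"
      by blast
    then have "x + h *\<^sub>R \<omega> \<in> grid_boundary h A"
      using True assms(2) unfolding grid_boundary_def by blast
    then show ?thesis
      using assms(1) by blast
  qed
  then show ?thesis
    by (simp add: discrete_div_stencil)
qed

lemma finite_grid_interior:
  assumes "h > 0" "bounded \<Omega>"
  shows "finite (grid_interior h \<Omega>)"
  by (rule finite_subset[OF _ finite_grid_bounded[OF assms]]) (auto simp: grid_interior_def)

lemma abs_truncate_vec_le:
  assumes "0 \<le> M"
  shows "\<bar>truncate_vec M w $ j\<bar> \<le> M"
  using assms by (auto simp: truncate_vec_def abs_mult sgn_real_def)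

lemma lp_norm_powr:
  assumes "1 \<le> p" "0 \<le> h"
  shows "lp_norm h p A \<phi> powr p = (\<Sum>\<^sub>\<infinity>x\<in>A. \<bar>\<phi> x\<bar> powr p * h ^ 3)"
proof -
  have "0 \<le> (\<Sum>\<^sub>\<infinity>x\<in>A. \<bar>\<phi> x\<bar> powr p * h ^ 3)"
    using assms by (intro infsum_nonneg) auto
  then show ?thesis
    using assms by (simp add: lp_norm_def powr_powr)
qed

section \<open>Cell averages of the initial data\<close>

text \<open>The constant density \<open>c\<close> normalises \<open>M\<close> to a probability
  measure, for which the mean is the average over \<open>M\<close>.\<close>

lemma (in finite_measure) jensen_average:
  fixes X :: "'a \<Rightarrow> real"
  assumes pos: "measure M (space M) > 0"
    and X: "integrable M X" "integrable M (\<lambda>x. q (X x))"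
    and q: "convex_on UNIV q"
  shows "q ((LINT x|M. X x) / measure M (space M)) \<le> (LINT x|M. q (X x)) / measure M (space M)"
proof -
  define c where "c = 1 / measure M (space M)"
  have c: "c > 0" using pos by (simp add: c_def)
  let ?U = "density M (\<lambda>_. ennreal c)"
  have "emeasure ?U (space ?U) = ennreal c * ennreal (measure M (space M))"
    by (simp add: emeasure_density emeasure_eq_measure nn_integral_cmult_indicator)
  also have "\<dots> = 1"
    using pos by (simp add: c_def ennreal_mult'[symmetric])
  finally interpret U: prob_space ?U
    by (rule prob_spaceI)
  have integral_U: "(LINT x|?U. Y x) = (LINT x|M. Y x) / measure M (space M)"
    and integrable_U: "integrable ?U Y" if "integrable M Y" for Y :: "'a \<Rightarrow> real"
    using that c by (simp_all add: integral_density integrable_density c_def)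
  show ?thesis
    using U.jensens_inequality[where X = X and I = UNIV and q = q] X q by (simp add: integral_U integrable_U)
qed

lemma cell_sets_lebesgue: "cell h x \<in> sets lebesgue"
proof -
  have "cell h x = (\<Inter>i. {y. y $ i \<ge> x $ i - h / 2} \<inter> {y. y $ i < x $ i + h / 2})"
    by (auto simp: cell_def)
  moreover have "{y :: real^3. y $ i \<ge> c} \<inter> {y. y $ i < d} \<in> sets borel" for i c d
    using closed_halfspace_component_ge_cart[of c i] open_halfspace_component_lt_cart[of i d]
    by (intro sets.Int) auto
  ultimately have "cell h x \<in> sets borel"
    by auto
  then show ?thesis by simp
qed

text \<open>The half-open cube lies between an open and a closed box of equal volume.\<close>

lemma emeasure_cell:
  assumes "h > 0"
  shows "emeasure lebesgue (cell h x) = ennreal (h ^ 3)"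
proof -
  let ?a = "x - (\<chi> i. h / 2)" and ?b = "x + (\<chi> i. h / 2)"
  have sub: "box ?a ?b \<subseteq> cell h x" "cell h x \<subseteq> cbox ?a ?b"
    by (fastforce simp: cell_def mem_box_cart intro: less_imp_le)+
  have ne: "cbox ?a ?b \<noteq> {}"
    using assms by (auto simp: interval_ne_empty_cart)
  have cbox: "emeasure lebesgue (cbox ?a ?b) = ennreal (h ^ 3)"
    using content_cbox_cart[OF ne] emeasure_lborel_cbox_finite[of ?a ?b]
    by (simp add: emeasure_eq_ennreal_measure)
  have box: "emeasure lebesgue (box ?a ?b) = ennreal (h ^ 3)"
    using cbox by (simp add: emeasure_lborel_box_eq emeasure_lborel_cbox_eq)
  show ?thesis
    using emeasure_mono[OF sub(1) cell_sets_lebesgue] emeasure_mono[OF sub(2), of lebesgue] cbox box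
    by (intro antisym) auto
qed

lemma cell_lmeasurable:
  assumes "h > 0"
  shows "cell h x \<in> lmeasurable"
proof (rule fmeasurableI)
  show "emeasure lebesgue (cell h x) < \<infinity>"
    unfolding emeasure_cell[OF assms] by simp
qed (rule cell_sets_lebesgue)

lemma measure_cell:
  assumes "h > 0"
  shows "measure (lebesgue_on (cell h x)) (cell h x) = h ^ 3"
proof -
  have "measure lebesgue (cell h x) = h ^ 3"
    unfolding measure_def emeasure_cell[OF assms] using assms by simp
  then show ?thesis
    by (simp add: measure_restrict_space cell_sets_lebesgue)
qed

text \<open>A common point forces the integer coordinates of the two centres to differ by less than
  \<open>1\<close>. The bound is strict because the cells are half-open.\<close>

lemma grid_cells_disjoint:
  assumes "h > 0" "x \<in> grid h" "y \<in> grid h" "x \<noteq> y"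
  shows "cell h x \<inter> cell h y = {}"
proof (rule ccontr)
  assume "cell h x \<inter> cell h y \<noteq> {}"
  then obtain p where p: "p \<in> cell h x" "p \<in> cell h y" by auto
  from assms obtain z w :: "3 \<Rightarrow> int"
    where zw: "\<And>i. x $ i = h * of_int (z i)" "\<And>i. y $ i = h * of_int (w i)"
    by (auto simp: grid_def)
  have "z i = w i" for i
  proof -
    have "h * of_int (z i) - h / 2 < h * of_int (w i) + h / 2"
      "h * of_int (w i) - h / 2 < h * of_int (z i) + h / 2"
      using p unfolding zw(1,2)[symmetric] cell_def by (blast intro: le_less_trans)+
    then have "h * of_int (z i) < h * of_int (w i + 1)" "h * of_int (w i) < h * of_int (z i + 1)"
      by (simp_all add: algebra_simps)
    then have "z i < w i + 1" "w i < z i + 1"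
      using assms(1) by (simp_all only: mult_less_cancel_left_pos of_int_less_iff)
    then show ?thesis by simp
  qed
  then have "x = y"
    by (simp add: vec_eq_iff zw)
  then show False
    using assms(4) by simp
qed

lemma cell_mono: "h \<le> k \<Longrightarrow> cell h x \<subseteq> cell k x"
  unfolding cell_def
proof clarify
  fix y i assume "h \<le> k" "\<forall>i. x $ i - h / 2 \<le> y $ i \<and> y $ i < x $ i + h / 2"
  then have "x $ i - h / 2 \<le> y $ i \<and> y $ i < x $ i + h / 2" "h \<le> k" by auto
  then show "x $ i - k / 2 \<le> y $ i \<and> y $ i < x $ i + k / 2" by argo
qed

lemma initial_avg_eq:
  "initial_avg h \<Omega> f x = (LINT y|lebesgue_on (cell h x). zero_ext \<Omega> f y) / h ^ 3"
  by (simp add: initial_avg_def set_lebesgue_integral_def integral_restrict_space cell_sets_lebesgue)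

lemma zero_ext_measurable:
  fixes f :: "real^3 \<Rightarrow> real"
  assumes "Linf \<Omega> f" "\<Omega> \<in> sets lebesgue"
  shows "zero_ext \<Omega> f \<in> borel_measurable lebesgue"
  using assms borel_measurable_if_I[of f \<Omega>] unfolding Linf_def zero_ext_def by simp

lemma zero_ext_AE_le:
  assumes "Linf \<Omega> f" "\<Omega> \<in> sets lebesgue"
  shows "AE x in lebesgue. \<bar>zero_ext \<Omega> f x\<bar> \<le> enn2real (Linf_norm \<Omega> f)"
proof -
  \<comment> \<open>The norm is finite by \<open>Linf\<close>, so it survives the passage to a real
    number and back.\<close>
  have "Linf_norm \<Omega> f = ennreal (enn2real (Linf_norm \<Omega> f))"
    using assms(1) by (simp add: Linf_def Linf_norm_def)
  then have "AE x in lebesgue_on \<Omega>. ennreal \<bar>f x\<bar> \<le> ennreal (enn2real (Linf_norm \<Omega> f))"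
    using esssup_AE[of "\<lambda>x. ennreal \<bar>f x\<bar>" "lebesgue_on \<Omega>"] by (simp add: Linf_norm_def)
  then have "AE x in lebesgue. x \<in> \<Omega> \<longrightarrow> \<bar>f x\<bar> \<le> enn2real (Linf_norm \<Omega> f)"
    using assms(2) by (simp add: AE_restrict_space_iff)
  then show ?thesis
    by eventually_elim (simp add: zero_ext_def)
qed

text \<open>Both functions are measurable and essentially bounded, and \<open>S\<close> has finite
  measure.\<close>

lemma integrable_zero_ext:
  assumes "Linf \<Omega> f" "\<Omega> \<in> sets lebesgue" "S \<in> lmeasurable" "0 \<le> p"
  shows "integrable (lebesgue_on S) (zero_ext \<Omega> f)"
    and "integrable (lebesgue_on S) (\<lambda>x. \<bar>zero_ext \<Omega> f x\<bar> powr p)"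
proof -
  interpret finite_measure "lebesgue_on S"
    by (rule finite_measure_lebesgue_on[OF assms(3)])
  let ?C = "enn2real (Linf_norm \<Omega> f)"
  have S: "S \<in> sets lebesgue"
    using assms(3) by auto
  have meas: "zero_ext \<Omega> f \<in> borel_measurable (lebesgue_on S)"
    using measurable_restrict_space1[OF zero_ext_measurable[OF assms(1,2)]] .
  have AE: "AE x in lebesgue_on S. \<bar>zero_ext \<Omega> f x\<bar> \<le> ?C"
    using zero_ext_AE_le[OF assms(1,2)] S by (auto simp: AE_restrict_space_iff)
  show "integrable (lebesgue_on S) (zero_ext \<Omega> f)"
    using AE meas by (intro integrable_const_bound[of _ ?C]) auto
  have "AE x in lebesgue_on S. norm (\<bar>zero_ext \<Omega> f x\<bar> powr p) \<le> ?C powr p"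
    using AE by eventually_elim (use assms(4) in \<open>auto intro: powr_mono2\<close>)
  moreover have "(\<lambda>x. \<bar>zero_ext \<Omega> f x\<bar> powr p) \<in> borel_measurable (lebesgue_on S)"
    using meas by measurable
  ultimately show "integrable (lebesgue_on S) (\<lambda>x. \<bar>zero_ext \<Omega> f x\<bar> powr p)"
    by (rule integrable_const_bound)
qed

lemma abs_initial_avg_le:
  assumes "Linf \<Omega> f" "\<Omega> \<in> sets lebesgue" "h > 0"
  shows "ennreal \<bar>initial_avg h \<Omega> f x\<bar> \<le> Linf_norm \<Omega> f"
proof -
  let ?C = "enn2real (Linf_norm \<Omega> f)" and ?F = "zero_ext \<Omega> f" and ?M = "lebesgue_on (cell h x)"
  interpret finite_measure ?M
    by (rule finite_measure_lebesgue_on[OF cell_lmeasurable[OF assms(3)]])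
  have int: "integrable ?M ?F"
    using integrable_zero_ext(1)[OF assms(1,2) cell_lmeasurable[OF assms(3)], of 0] by simp
  have "\<bar>LINT y|?M. ?F y\<bar> \<le> (LINT y|?M. \<bar>?F y\<bar>)"
    by (rule integral_abs_bound)
  also have "\<dots> \<le> (LINT y|?M. ?C)"
    using int zero_ext_AE_le[OF assms(1,2)]
    by (intro integral_mono_AE) (auto simp: AE_restrict_space_iff cell_sets_lebesgue)
  also have "\<dots> = ?C * h ^ 3"
    by (simp add: measure_cell[OF assms(3)])
  finally have "\<bar>initial_avg h \<Omega> f x\<bar> \<le> ?C"
    using assms(3) by (simp add: initial_avg_eq field_simps)
  then have "ennreal \<bar>initial_avg h \<Omega> f x\<bar> \<le> ennreal ?C"
    by (rule ennreal_leI)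
  also have "\<dots> = Linf_norm \<Omega> f"
    using assms(1) by (simp add: Linf_def Linf_norm_def)
  finally show ?thesis .
qed

text \<open>Jensen on each cell bounds a summand by an integral over that cell. The cells are
  disjoint and contained in \<open>\<Omega>\<close>, so these integrals add up to at most the
  integral over \<open>\<Omega>\<close>.\<close>

lemma sum_initial_avg_powr_le:
  assumes "Linf \<Omega> f" "open \<Omega>" "bounded \<Omega>" "h > 0" "1 \<le> p"
  shows "(\<Sum>x\<in>grid_interior h \<Omega>. \<bar>initial_avg h \<Omega> f x\<bar> powr p * h ^ 3)
    \<le> (LINT x|lebesgue_on \<Omega>. \<bar>f x\<bar> powr p)"
proof -
  let ?F = "zero_ext \<Omega> f"
  note fin = finite_grid_interior[OF assms(4,3)]
  have \<Omega>: "\<Omega> \<in> lmeasurable" "\<Omega> \<in> sets lebesgue"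
    using assms(2,3) by (auto simp: lmeasurable_open)
  note cell = cell_lmeasurable[OF assms(4)]
  note int = integrable_zero_ext[OF assms(1) \<Omega>(2), of _ p]
  have avg: "\<bar>initial_avg h \<Omega> f x\<bar> powr p * h ^ 3 \<le> (LINT y:cell h x|lebesgue. \<bar>?F y\<bar> powr p)" for x
  proof -
    interpret finite_measure "lebesgue_on (cell h x)"
      by (rule finite_measure_lebesgue_on[OF cell])
    have "\<bar>initial_avg h \<Omega> f x\<bar> powr p \<le> (LINT y|lebesgue_on (cell h x). \<bar>?F y\<bar> powr p) / h ^ 3"
      using jensen_average[of ?F "\<lambda>r. \<bar>r\<bar> powr p"] int[OF cell] assms(4,5) convex_abs_powr[OF assms(5)]
      by (simp add: measure_cell initial_avg_eq)
    then show ?thesis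
      using assms(4) cell_sets_lebesgue
      by (simp add: field_simps set_lebesgue_integral_def integral_restrict_space)
  qed
  \<comment> \<open>Membership in \<open>grid_interior\<close> is stated through cells of side
    \<open>2 * h\<close>, which contain those of side \<open>h\<close>.\<close>
  have sub: "(\<Union>x\<in>grid_interior h \<Omega>. cell h x) \<subseteq> \<Omega>"
    using cell_mono[of h "2 * h"] assms(4) by (fastforce simp: grid_interior_def)
  have "(\<Sum>x\<in>grid_interior h \<Omega>. \<bar>initial_avg h \<Omega> f x\<bar> powr p * h ^ 3)
      \<le> (\<Sum>x\<in>grid_interior h \<Omega>. LINT y:cell h x|lebesgue. \<bar>?F y\<bar> powr p)"
    by (intro sum_mono avg)
  also have "\<dots> = (LINT y:(\<Union>x\<in>grid_interior h \<Omega>. cell h x)|lebesgue. \<bar>?F y\<bar> powr p)"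
  proof (rule set_integral_finite_Union[symmetric])
    show "disjoint_family_on (cell h) (grid_interior h \<Omega>)"
      using grid_cells_disjoint[OF assms(4)] by (auto simp: disjoint_family_on_def grid_interior_def)
    show "set_integrable lebesgue (cell h x) (\<lambda>y. \<bar>?F y\<bar> powr p)" for x
      using int(2)[OF cell] assms(5) cell_sets_lebesgue
      by (simp add: set_integrable_def integrable_restrict_space)
  qed (use fin cell_sets_lebesgue in auto)
  also have "\<dots> = (LINT y|lebesgue_on (\<Union>x\<in>grid_interior h \<Omega>. cell h x). \<bar>?F y\<bar> powr p)"
    using fin cell_sets_lebesgue
    by (simp add: set_lebesgue_integral_def integral_restrict_space sets.finite_UN)
  also have "\<dots> \<le> (LINT y|lebesgue_on \<Omega>. \<bar>?F y\<bar> powr p)"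
    using sub int(2)[OF \<Omega>(1)] assms(5) \<Omega>(2) fin cell_sets_lebesgue
    by (intro integral_mono_lebesgue_on_AE) (auto intro!: sets.finite_UN)
  also have "\<dots> = (LINT x|lebesgue_on \<Omega>. \<bar>f x\<bar> powr p)"
    by (intro Bochner_Integration.integral_cong) (auto simp: zero_ext_def)
  finally show ?thesis .
qed

theorem theorem3p1:
  fixes T h \<tau> \<alpha> \<beta> :: real and N :: nat
    and \<Omega> :: "(real^3) set"
    and v :: "real \<Rightarrow> real^3 \<Rightarrow> real^3"
    and f0 :: "real^3 \<Rightarrow> real"
    and u ut :: "nat \<Rightarrow> real^3 \<Rightarrow> real^3"
    and g :: "nat \<Rightarrow> real^3 \<Rightarrow> real"
  assumes "T > 0"
    and "bounded \<Omega>" "connected \<Omega>" "open \<Omega>"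
    and "L2_H1_0 T \<Omega> v" "Linf_L2 T \<Omega> v" "divergence_free T \<Omega> v"
    and "ess_support (zero_ext ({0..T} \<times> \<Omega>) (\<lambda>(t, x). v t x)) \<subseteq> {0..T} \<times> \<Omega>"
    and "Linf \<Omega> f0"
    and "\<exists>U. open U \<and> frontier \<Omega> \<subseteq> U \<and> (AE x in lebesgue_on \<Omega>. x \<in> U \<longrightarrow> f0 x = 0)"
    and "h > 0" "\<tau> = h powr (2 - \<alpha>)"
    and "h powr (1 - (\<alpha> + \<beta>)) \<le> 2 / 7" "\<alpha> > 0" "\<beta> > 1 / 2" "\<alpha> + \<beta> < 1"
    and "T \<in> {\<tau> * real N..<\<tau> * real N + \<tau>}"
    and u: "\<And>n x. u n x = velocity_avg h \<tau> \<Omega> v n x"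
    and ut: "\<And>n x. ut n x = truncate_vec (h powr (- \<beta>)) (u n x)"
    and g0: "\<And>x. x \<in> grid h \<Longrightarrow> g 0 x = initial_avg h \<Omega> f0 x"
    and g0_vanish: "\<And>x. x \<in> grid_boundary h (grid_interior h \<Omega>) \<union> (grid h - grid_interior h \<Omega>)
           \<Longrightarrow> g 0 x = 0"
    and u_vanish: "\<And>n x. n < N \<Longrightarrow>
           x \<in> grid_boundary h (grid_interior h \<Omega>) \<union> (grid h - grid_interior h \<Omega>) \<Longrightarrow> u n x = 0"
    and scheme: "solves_scheme h \<tau> N ut g"
  shows "(\<forall>n. 1 \<le> n \<and> n \<le> N \<longrightarrow>
           linf_norm (grid h) (g n) \<le> linf_norm (grid h) (g 0) \<and>
           linf_norm (grid h) (g 0) \<le> Linf_norm \<Omega> f0)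
    \<and> (\<forall>n (p::real). 1 \<le> n \<and> n \<le> N \<and> 1 \<le> p \<longrightarrow>
           (\<forall>m\<le>n. (\<lambda>x. \<bar>g m x\<bar> powr p * h ^ 3) summable_on grid h) \<and>
           (\<forall>m<n. (\<lambda>x. discrete_div h (ut m) x * \<bar>g m x\<bar> powr p * h ^ 3 * \<tau>) summable_on grid h) \<and>
           lp_norm h p (grid h) (g n) powr p
             \<le> lp_norm h p (grid h) (g 0) powr p
               + (\<Sum>m<n. \<Sum>\<^sub>\<infinity>x\<in>grid h. discrete_div h (ut m) x * \<bar>g m x\<bar> powr p * h ^ 3 * \<tau>) \<and>
           lp_norm h p (grid h) (g 0) powr p
               + (\<Sum>m<n. \<Sum>\<^sub>\<infinity>x\<in>grid h. discrete_div h (ut m) x * \<bar>g m x\<bar> powr p * h ^ 3 * \<tau>)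
             = lp_norm h p (grid_interior h \<Omega>) (g 0) powr p
               + (\<Sum>m<n. \<Sum>x\<in>grid_interior h \<Omega>.
                    discrete_div h (ut m) x * \<bar>g m x\<bar> powr p * h ^ 3 * \<tau>) \<and>
           lp_norm h p (grid_interior h \<Omega>) (g 0) powr p
               + (\<Sum>m<n. \<Sum>x\<in>grid_interior h \<Omega>.
                    discrete_div h (ut m) x * \<bar>g m x\<bar> powr p * h ^ 3 * \<tau>)
             \<le> Lp_norm p \<Omega> f0 powr p
               + (\<Sum>m<n. \<Sum>x\<in>grid_interior h \<Omega>.
                    discrete_div h (ut m) x * \<bar>g m x\<bar> powr p * h ^ 3 * \<tau>))
    \<and> (\<forall>gt. solves_scheme h \<tau> N ut gt \<and> (\<forall>x\<in>grid h. g 0 x \<le> gt 0 x) \<longrightarrow>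
           (\<forall>n. 1 \<le> n \<and> n \<le> N \<longrightarrow> (\<forall>x\<in>grid h. g n x \<le> gt n x)))"
proof -

  \<comment> \<open>Step size condition and supports\<close>
  note h = \<open>h > 0\<close>
  have \<tau>: "\<tau> > 0"
    using h \<open>\<tau> = _\<close> by simp
  have \<Omega>: "\<Omega> \<in> sets lebesgue"
    using \<open>open \<Omega>\<close> by simp
  \<comment> \<open>The exponent \<open>2 - \<alpha> - \<beta>\<close> is split as
    \<open>(1 - (\<alpha> + \<beta>)) + 1\<close>; the smallness assumption on \<open>h\<close> then
    gives exactly the threshold of \<open>stencil_weight_nonneg\<close>.\<close>
  have "\<tau> * h powr (- \<beta>) = h powr (1 - (\<alpha> + \<beta>)) * h powr 1"
    unfolding \<open>\<tau> = _\<close> powr_add[symmetric] by (simp add: algebra_simps)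
  then have *: "\<tau> * h powr (- \<beta>) \<le> 2 / 7 * h"
    using h \<open>h powr (1 - (\<alpha> + \<beta>)) \<le> 2 / 7\<close> by simp
  then have CFL: "\<tau> * \<bar>ut n x $ j\<bar> \<le> 2 / 7 * h" for n x j
  proof -
    have "\<tau> * \<bar>ut n x $ j\<bar> \<le> \<tau> * h powr (- \<beta>)"
      unfolding ut using \<tau> by (intro mult_left_mono abs_truncate_vec_le) auto
    with * show ?thesis by (rule order_trans[rotated])
  qed
  have g_Suc: "g (Suc n) x = scheme_update h \<tau> (ut n) (g n) x" if "n < N" "x \<in> grid h" for n x
    using scheme that by (simp add: solves_scheme_iff_update[OF \<tau>])
  have fin_int: "finite (grid_interior h \<Omega>)"
    by (rule finite_grid_interior[OF h \<open>bounded \<Omega>\<close>])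
  have fin_supp: "finite {x \<in> grid h. g n x \<noteq> 0}" if "n \<le> N" for n
    using that
  proof (induction n)
    case 0
    show ?case
      by (rule finite_subset[OF _ fin_int]) (use g0_vanish in auto)
  next
    case (Suc n)
    then show ?case
      using scheme_update_finite_support[of h "g n" \<tau> "ut n"]
      by (simp add: g_Suc cong: conj_cong)
  qed
  \<comment> \<open>Truncation maps \<open>0\<close> to \<open>0\<close>, so \<open>ut\<close>
    inherits the vanishing of \<open>u\<close> on and beyond the boundary.\<close>
  have div0: "discrete_div h (ut m) x = 0" if "m < N" "x \<in> grid h - grid_interior h \<Omega>" for m x
    using that u_vanish[OF that(1)]
    by (intro discrete_div_eq_0_outside[of h "grid_interior h \<Omega>"])
      (auto simp: ut truncate_vec_def vec_eq_iff)
  have int_sub: "grid_interior h \<Omega> \<subseteq> grid h"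
    by (auto simp: grid_interior_def)

  \<comment> \<open>Maximum norm estimate\<close>
  have Linf: "linf_norm (grid h) (g n) \<le> linf_norm (grid h) (g 0)" if "n \<le> N" for n
    using that
  proof (induction n)
    case (Suc n)
    have "ennreal \<bar>g (Suc n) x\<bar> \<le> linf_norm (grid h) (g n)" if x: "x \<in> grid h" for x
    \<comment> \<open>The value \<open>top\<close> makes the bound trivial; otherwise the norm is a
      real \<open>M\<close> bounding all grid values of \<open>g n\<close>.\<close>
    proof (cases "linf_norm (grid h) (g n)")
      case (real M)
      have "\<bar>g n y\<bar> \<le> M" if "y \<in> grid h" for y
      proof -
        have "ennreal \<bar>g n y\<bar> \<le> ennreal M"
          unfolding real(2)[symmetric] linf_norm_def using that by (rule SUP_upper)
        then show ?thesis
          using real(1) by simp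
      qed
      then have "\<bar>g (Suc n) x\<bar> \<le> M"
        using Suc.prems x g_Suc scheme_update_bound[OF h \<tau> CFL x] by simp
      then show ?thesis
        using real by (simp add: ennreal_leI)
    qed simp
    then have "linf_norm (grid h) (g (Suc n)) \<le> linf_norm (grid h) (g n)"
      unfolding linf_norm_def[of _ "g (Suc n)"] by (rule SUP_least)
    with Suc show ?case by simp
  qed simp
  have Linf0: "linf_norm (grid h) (g 0) \<le> Linf_norm \<Omega> f0"
    unfolding linf_norm_def
    using abs_initial_avg_le[OF \<open>Linf \<Omega> f0\<close> \<Omega> h] by (intro SUP_least) (simp add: g0)

  \<comment> \<open>Estimates of the \<open>p\<close>-th powers\<close>
  have Lp: "(\<forall>m\<le>n. (\<lambda>x. \<bar>g m x\<bar> powr p * h ^ 3) summable_on grid h) \<and>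
      (\<forall>m<n. (\<lambda>x. discrete_div h (ut m) x * \<bar>g m x\<bar> powr p * h ^ 3 * \<tau>) summable_on grid h) \<and>
      lp_norm h p (grid h) (g n) powr p
        \<le> lp_norm h p (grid h) (g 0) powr p
          + (\<Sum>m<n. \<Sum>\<^sub>\<infinity>x\<in>grid h. discrete_div h (ut m) x * \<bar>g m x\<bar> powr p * h ^ 3 * \<tau>) \<and>
      lp_norm h p (grid h) (g 0) powr p
          + (\<Sum>m<n. \<Sum>\<^sub>\<infinity>x\<in>grid h. discrete_div h (ut m) x * \<bar>g m x\<bar> powr p * h ^ 3 * \<tau>)
        = lp_norm h p (grid_interior h \<Omega>) (g 0) powr p
          + (\<Sum>m<n. \<Sum>x\<in>grid_interior h \<Omega>.
               discrete_div h (ut m) x * \<bar>g m x\<bar> powr p * h ^ 3 * \<tau>) \<and>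
      lp_norm h p (grid_interior h \<Omega>) (g 0) powr p
          + (\<Sum>m<n. \<Sum>x\<in>grid_interior h \<Omega>.
               discrete_div h (ut m) x * \<bar>g m x\<bar> powr p * h ^ 3 * \<tau>)
        \<le> Lp_norm p \<Omega> f0 powr p
          + (\<Sum>m<n. \<Sum>x\<in>grid_interior h \<Omega>.
               discrete_div h (ut m) x * \<bar>g m x\<bar> powr p * h ^ 3 * \<tau>)"
    if n: "n \<le> N" and p: "1 \<le> p" for n p
  proof (intro conjI allI impI)
    note norm = lp_norm_powr[OF p less_imp_le[OF h]]
    show "(\<lambda>x. \<bar>g m x\<bar> powr p * h ^ 3) summable_on grid h" if "m \<le> n" for m
      by (intro summable_on_finite_support finite_subset[OF _ fin_supp[of m]]) (use that n in auto)
    show "(\<lambda>x. discrete_div h (ut m) x * \<bar>g m x\<bar> powr p * h ^ 3 * \<tau>) summable_on grid h"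
      if "m < n" for m
      by (intro summable_on_finite_support finite_subset[OF _ fin_supp[of m]]) (use that n in auto)
    have conv: "convex_on UNIV (\<lambda>a::real. \<bar>a\<bar> powr p)"
      by (rule convex_abs_powr[OF p])
    \<comment> \<open>The cell volume is absorbed into the convex function, so that the Jensen
      estimate produces the weighted sums of \<open>lp_norm\<close> directly.\<close>
    have "convex_on UNIV (\<lambda>a::real. h ^ 3 * \<bar>a\<bar> powr p)"
      using h by (intro convex_on_cmul conv) simp
    then have q: "convex_on UNIV (\<lambda>a::real. \<bar>a\<bar> powr p * h ^ 3)"
      by (simp add: mult.commute)
    show "lp_norm h p (grid h) (g n) powr p
        \<le> lp_norm h p (grid h) (g 0) powr p
          + (\<Sum>m<n. \<Sum>\<^sub>\<infinity>x\<in>grid h. discrete_div h (ut m) x * \<bar>g m x\<bar> powr p * h ^ 3 * \<tau>)"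
      using n
    proof (induction n)
      case (Suc n)
      have "(\<Sum>\<^sub>\<infinity>x\<in>grid h. \<bar>g (Suc n) x\<bar> powr p * h ^ 3)
          = (\<Sum>\<^sub>\<infinity>x\<in>grid h. \<bar>scheme_update h \<tau> (ut n) (g n) x\<bar> powr p * h ^ 3)"
        using Suc.prems by (intro infsum_cong) (simp add: g_Suc)
      also have "\<dots> \<le> (\<Sum>\<^sub>\<infinity>x\<in>grid h. \<bar>g n x\<bar> powr p * h ^ 3)
          + (\<Sum>\<^sub>\<infinity>x\<in>grid h. discrete_div h (ut n) x * (\<bar>g n x\<bar> powr p * h ^ 3) * \<tau>)"
        using Suc.prems by (intro infsum_scheme_update_jensen h \<tau> CFL q fin_supp) auto
      finally show ?case
        using Suc by (simp add: norm mult.assoc)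
    qed simp
    \<comment> \<open>Two different reasons remove the terms off
      \<open>grid_interior h \<Omega>\<close>: in the norm it is \<open>g 0\<close> that vanishes
      there, in the later sums it is the divergence.\<close>
    have "(\<Sum>\<^sub>\<infinity>x\<in>grid h. \<bar>g 0 x\<bar> powr p * h ^ 3)
        = (\<Sum>\<^sub>\<infinity>x\<in>grid_interior h \<Omega>. \<bar>g 0 x\<bar> powr p * h ^ 3)"
      using int_sub g0_vanish by (intro infsum_cong_neutral) auto
    moreover have "(\<Sum>\<^sub>\<infinity>x\<in>grid h. discrete_div h (ut m) x * \<bar>g m x\<bar> powr p * h ^ 3 * \<tau>)
        = (\<Sum>x\<in>grid_interior h \<Omega>. discrete_div h (ut m) x * \<bar>g m x\<bar> powr p * h ^ 3 * \<tau>)"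
      if "m < n" for m
      unfolding infsum_finite[OF fin_int, symmetric]
      using int_sub div0[of m] that n by (intro infsum_cong_neutral) auto
    ultimately show "lp_norm h p (grid h) (g 0) powr p
          + (\<Sum>m<n. \<Sum>\<^sub>\<infinity>x\<in>grid h. discrete_div h (ut m) x * \<bar>g m x\<bar> powr p * h ^ 3 * \<tau>)
        = lp_norm h p (grid_interior h \<Omega>) (g 0) powr p
          + (\<Sum>m<n. \<Sum>x\<in>grid_interior h \<Omega>.
               discrete_div h (ut m) x * \<bar>g m x\<bar> powr p * h ^ 3 * \<tau>)"
      by (simp add: norm)
    have "lp_norm h p (grid_interior h \<Omega>) (g 0) powr p
        = (\<Sum>x\<in>grid_interior h \<Omega>. \<bar>initial_avg h \<Omega> f0 x\<bar> powr p * h ^ 3)"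
      unfolding norm infsum_finite[OF fin_int] using int_sub g0 by (intro sum.cong) auto
    also have "\<dots> \<le> (LINT x|lebesgue_on \<Omega>. \<bar>f0 x\<bar> powr p)"
      by (rule sum_initial_avg_powr_le[OF \<open>Linf \<Omega> f0\<close> \<open>open \<Omega>\<close> \<open>bounded \<Omega>\<close> h p])
    also have "\<dots> = Lp_norm p \<Omega> f0 powr p"
      using p by (simp add: Lp_norm_def powr_powr)
    finally show "lp_norm h p (grid_interior h \<Omega>) (g 0) powr p
          + (\<Sum>m<n. \<Sum>x\<in>grid_interior h \<Omega>.
               discrete_div h (ut m) x * \<bar>g m x\<bar> powr p * h ^ 3 * \<tau>)
        \<le> Lp_norm p \<Omega> f0 powr p
          + (\<Sum>m<n. \<Sum>x\<in>grid_interior h \<Omega>.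
               discrete_div h (ut m) x * \<bar>g m x\<bar> powr p * h ^ 3 * \<tau>)"
      by (rule add_right_mono)
  qed

  \<comment> \<open>Comparison principle\<close>
  have comparison: "g n x \<le> gt n x"
    if gt: "solves_scheme h \<tau> N ut gt" "\<forall>x\<in>grid h. g 0 x \<le> gt 0 x" and "n \<le> N" "x \<in> grid h"
    for gt n x
    using that(3,4)
  \<comment> \<open>The point \<open>x\<close> is generalised because a step at \<open>x\<close>
    reads the previous level at all stencil neighbours.\<close>
  proof (induction n arbitrary: x)
    case 0
    then show ?case using gt(2) by simp
  next
    case (Suc n)
    then have "g (Suc n) x = scheme_update h \<tau> (ut n) (g n) x"
      "gt (Suc n) x = scheme_update h \<tau> (ut n) (gt n) x"
      using g_Suc gt(1) by (simp_all add: solves_scheme_iff_update[OF \<tau>])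
    then show ?case
      using scheme_update_mono[of h \<tau> "ut n" x "g n" "gt n", OF h \<tau> CFL] Suc by simp
  qed

  show ?thesis
    using Linf Linf0 Lp comparison by blast
qed

end
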